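(* Let $\Omega>0$, let $s\in\mathbf{R}$ and $q\in[-\infty,s)$, let $N<+\infty$ be a non-negative integer, and let $x\in L_2(-\infty,+\infty)$. Let $G$, $R$, $r$ be as defined in the context. Then: (i) The operator $R$ is positive definite. (ii) The problem of minimizing $G(y,x)$ over $y\in\mathbf{C}^{2N+1}$ has a unique solution, namely $\widehat y=R^{-1}rx$. (iii) The components of the matrix $R=\{R_{km}\}_{k,m=-N}^N$ are given by $$R_{km}=\frac{\Omega^2}{\pi^2}\int_q^s\operatorname{sinc}(m\pi+\Omega t)\,\operatorname{sinc}(k\pi+\Omega t)\,dt.$$ (iv) The components of the vector $rx=\{(rx)_k\}_{k=-N}^N$ are given by $$(rx)_k=\frac{\Omega}{\pi}\int_q^s\operatorname{sinc}(k\pi+\Omega t)\,x(t)\,dt.$$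
   Context: All functions are complex valued, and $L_2(q,s)$ is the usual Hilbert space of complex valued square integrable functions on $(q,s)$ ($q=-\infty$ is allowed). Notation: $\operatorname{sinc}(u)=\sin(u)/u$ (with $\operatorname{sinc}(0)=1$). Vectors in $\mathbf{C}^{2N+1}$ are indexed as $y=\{y_k\}_{k=-N}^N$, and $(\cdot,\cdot)_H$ denotes the inner product of a Hilbert space $H$. The inverse Fourier transform is $(\mathcal{F}^{-1}X)(t)=\frac1{2\pi}\int_{-\infty}^{\infty}X(i\omega)e^{i\omega t}\,d\omega$. For $y\in\mathbf{C}^{2N+1}$, let $\mathcal{Q}y\in L_2(q,s)$ be the restriction to $(q,s)$ of $\mathcal{F}^{-1}X$, where $X(i\omega)=\sum_{k=-N}^N y_k e^{ik\omega\pi/\Omega}\mathbb{I}_{\{|\omega|\le\Omega\}}$ and $\mathbb{I}$ is the indicator function; explicitly, $(\mathcal{Q}y)(t)=\frac{\Omega}{\pi}\sum_{k=-N}^N y_k\operatorname{sinc}(k\pi+\Omega t)$. For $y\in\mathbf{C}^{2N+1}$ and $x\in L_2(q,s)$ (a function on $\mathbf{R}$ is restricted to $(q,s)$), define $$G(y,x)=\int_q^s|(\mathcal{Q}y)(t)-x(t)|^2\,dt.$$ The operators $R$, $r$ are determined by the expansion $$G(y,x)=(y,Ry)_{\mathbf{C}^{2N+1}}-2\operatorname{Re}(y,rx)_{\mathbf{C}^{2N+1}}+(\rho x,x)_{L_2(q,s)}\quad\text{for all } y\in\mathbf{C}^{2N+1},\ x\in L_2(q,s),$$ where $R:\mathbf{C}^{2N+1}\to\mathbf{C}^{2N+1}$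 is a linear Hermitian operator, $r:L_2(q,s)\to\mathbf{C}^{2N+1}$ is a bounded linear operator, and $\rho:L_2(q,s)\to L_2(q,s)$ is a bounded linear Hermitian operator. $R$ is identified with its matrix, $(Ry)_k=\sum_{m=-N}^N R_{km}y_m$. *)

theory Defs
  imports "HOL-Probability.Sinc_Integral"
begin

subsection \<open>The space \<open>C\<^sup>2\<^sup>N\<^sup>+\<^sup>1\<close>, indexed by \<open>-N, \<dots>, N\<close>\<close>

definition indices :: "nat \<Rightarrow> int set" where
  "indices N = {- int N..int N}"

text \<open>Vectors are functions on \<open>int\<close> that vanish off the index set, so that equality of
  vectors is equality in HOL.\<close>

definition cvec :: "nat \<Rightarrow> (int \<Rightarrow> complex) set" where
  "cvec N = {y. \<forall>k. k \<notin> indices N \<longrightarrow> y k = 0}"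

definition cvec_inner :: "nat \<Rightarrow> (int \<Rightarrow> complex) \<Rightarrow> (int \<Rightarrow> complex) \<Rightarrow> complex" where
  "cvec_inner N y z = (\<Sum>k\<in>indices N. y k * cnj (z k))"

definition cvec_norm :: "nat \<Rightarrow> (int \<Rightarrow> complex) \<Rightarrow> real" where
  "cvec_norm N y = sqrt (\<Sum>k\<in>indices N. (cmod (y k))\<^sup>2)"

definition linear_hermitian_cvec :: "nat \<Rightarrow> ((int \<Rightarrow> complex) \<Rightarrow> (int \<Rightarrow> complex)) \<Rightarrow> bool" where
  "linear_hermitian_cvec N R \<longleftrightarrow>
     (\<forall>y\<in>cvec N. R y \<in> cvec N) \<and>
     (\<forall>a b. \<forall>y\<in>cvec N. \<forall>z\<in>cvec N.
        R (\<lambda>k. a * y k + b * z k) = (\<lambda>k. a * R y k + b * R z k)) \<and>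
     (\<forall>y\<in>cvec N. \<forall>z\<in>cvec N. cvec_inner N (R y) z = cvec_inner N y (R z))"

definition positive_definite :: "nat \<Rightarrow> ((int \<Rightarrow> complex) \<Rightarrow> (int \<Rightarrow> complex)) \<Rightarrow> bool" where
  "positive_definite N R \<longleftrightarrow>
     (\<forall>y\<in>cvec N. y \<noteq> (\<lambda>_. 0) \<longrightarrow>
        cvec_inner N y (R y) \<in> \<real> \<and> Re (cvec_inner N y (R y)) > 0)"

definition unit_cvec :: "int \<Rightarrow> int \<Rightarrow> complex" where
  "unit_cvec m = (\<lambda>k. if k = m then 1 else 0)"

definition matrix_entry :: "((int \<Rightarrow> complex) \<Rightarrow> (int \<Rightarrow> complex)) \<Rightarrow> int \<Rightarrow> int \<Rightarrow> complex" where
  "matrix_entry R k m = R (unit_cvec m) k"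


subsection \<open>The space \<open>L\<^sub>2(A)\<close>\<close>

text \<open>Elements are square integrable functions rather than classes modulo null sets, and
  identities between elements are stated almost everywhere.  A bounded linear operator in the
  sense below maps functions that agree a.e. to vectors that agree (functions that agree a.e.).\<close>

definition L2 :: "real set \<Rightarrow> (real \<Rightarrow> complex) set" where
  "L2 A = {x. x \<in> borel_measurable (lebesgue_on A) \<and>
              integrable (lebesgue_on A) (\<lambda>t. (cmod (x t))\<^sup>2)}"

definition L2_inner :: "real set \<Rightarrow> (real \<Rightarrow> complex) \<Rightarrow> (real \<Rightarrow> complex) \<Rightarrow> complex" where
  "L2_inner A x z = (LINT t|lebesgue_on A. x t * cnj (z t))"

definition L2_norm :: "real set \<Rightarrow> (real \<Rightarrow> complex) \<Rightarrow> real" where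
  "L2_norm A x = sqrt (LINT t|lebesgue_on A. (cmod (x t))\<^sup>2)"

definition bounded_linear_L2_cvec ::
    "real set \<Rightarrow> nat \<Rightarrow> ((real \<Rightarrow> complex) \<Rightarrow> (int \<Rightarrow> complex)) \<Rightarrow> bool" where
  "bounded_linear_L2_cvec A N r \<longleftrightarrow>
     (\<forall>x\<in>L2 A. r x \<in> cvec N) \<and>
     (\<forall>a b. \<forall>x\<in>L2 A. \<forall>z\<in>L2 A.
        r (\<lambda>t. a * x t + b * z t) = (\<lambda>k. a * r x k + b * r z k)) \<and>
     (\<exists>C. \<forall>x\<in>L2 A. cvec_norm N (r x) \<le> C * L2_norm A x)"

definition bounded_linear_hermitian_L2 ::
    "real set \<Rightarrow> ((real \<Rightarrow> complex) \<Rightarrow> (real \<Rightarrow> complex)) \<Rightarrow> bool" where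
  "bounded_linear_hermitian_L2 A \<rho> \<longleftrightarrow>
     (\<forall>x\<in>L2 A. \<rho> x \<in> L2 A) \<and>
     (\<forall>a b. \<forall>x\<in>L2 A. \<forall>z\<in>L2 A. AE t in lebesgue_on A.
        \<rho> (\<lambda>t. a * x t + b * z t) t = a * \<rho> x t + b * \<rho> z t) \<and>
     (\<exists>C. \<forall>x\<in>L2 A. L2_norm A (\<rho> x) \<le> C * L2_norm A x) \<and>
     (\<forall>x\<in>L2 A. \<forall>z\<in>L2 A. L2_inner A (\<rho> x) z = L2_inner A x (\<rho> z))"


subsection \<open>The approximation functional\<close>

text \<open>A Fourier transform \<open>X\<close> given on the imaginary axis is represented by the function
  \<open>\<omega> \<mapsto> X(i\<omega>)\<close> of the real variable \<open>\<omega>\<close>.\<close>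

definition inverse_fourier :: "(real \<Rightarrow> complex) \<Rightarrow> real \<Rightarrow> complex" where
  "inverse_fourier X t =
     1 / (2 * complex_of_real pi) * (LINT \<omega>|lebesgue. X \<omega> * exp (\<i> * complex_of_real (\<omega> * t)))"

definition spectrum :: "real \<Rightarrow> nat \<Rightarrow> (int \<Rightarrow> complex) \<Rightarrow> real \<Rightarrow> complex" where
  "spectrum \<Omega> N y \<omega> =
     (\<Sum>k\<in>indices N. y k * exp (\<i> * complex_of_real (of_int k * \<omega> * pi / \<Omega>))
        * indicator {\<omega>. \<bar>\<omega>\<bar> \<le> \<Omega>} \<omega>)"

definition Q :: "real \<Rightarrow> nat \<Rightarrow> (int \<Rightarrow> complex) \<Rightarrow> real \<Rightarrow> complex" where
  "Q \<Omega> N y = inverse_fourier (spectrum \<Omega> N y)"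

definition G :: "real \<Rightarrow> nat \<Rightarrow> real set \<Rightarrow> (int \<Rightarrow> complex) \<Rightarrow> (real \<Rightarrow> complex) \<Rightarrow> real" where
  "G \<Omega> N A y x = (LINT t|lebesgue_on A. (cmod (Q \<Omega> N y t - x t))\<^sup>2)"

definition is_expansion :: "real \<Rightarrow> nat \<Rightarrow> real set \<Rightarrow> ((int \<Rightarrow> complex) \<Rightarrow> (int \<Rightarrow> complex)) \<Rightarrow>
    ((real \<Rightarrow> complex) \<Rightarrow> (int \<Rightarrow> complex)) \<Rightarrow> ((real \<Rightarrow> complex) \<Rightarrow> (real \<Rightarrow> complex)) \<Rightarrow> bool" where
  "is_expansion \<Omega> N A R r \<rho> \<longleftrightarrow>
     linear_hermitian_cvec N R \<and> bounded_linear_L2_cvec A N r \<and> bounded_linear_hermitian_L2 A \<rho> \<and>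
     (\<forall>y\<in>cvec N. \<forall>x\<in>L2 A.
        complex_of_real (G \<Omega> N A y x) =
          cvec_inner N y (R y) - 2 * complex_of_real (Re (cvec_inner N y (r x)))
            + L2_inner A (\<rho> x) x)"

text \<open>The expansion determines \<open>R\<close> on \<open>cvec N\<close> and \<open>r\<close> on \<open>L2 A\<close>; the choice operator
  only leaves open their values on functions outside these spaces.\<close>

definition opR :: "real \<Rightarrow> nat \<Rightarrow> real set \<Rightarrow> (int \<Rightarrow> complex) \<Rightarrow> (int \<Rightarrow> complex)" where
  "opR \<Omega> N A = (SOME R. \<exists>r \<rho>. is_expansion \<Omega> N A R r \<rho>)"

definition opr :: "real \<Rightarrow> nat \<Rightarrow> real set \<Rightarrow> (real \<Rightarrow> complex) \<Rightarrow> (int \<Rightarrow> complex)" where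
  "opr \<Omega> N A = (SOME r. \<exists>R \<rho>. is_expansion \<Omega> N A R r \<rho>)"

end

theory Submission
  imports Defs "HOL-Library.Function_Algebras"
begin

text \<open>
  Let \<open>e\<^sub>k\<close> be the function \<open>t \<mapsto> (\<Omega> / pi) * sinc (k * pi + \<Omega> * t)\<close>.  The inverse Fourier
  transform of \<open>\<omega> \<mapsto> exp (\<i> * k * \<omega> * pi / \<Omega>)\<close> cut off to the band of frequencies up to \<open>\<Omega>\<close> is
  exactly \<open>e\<^sub>k\<close> (lemma \<open>Q_eq_sincs\<close>), so \<open>Q\<close> is the synthesis map \<open>T\<close> sending \<open>y\<close> to the
  combination of the \<open>e\<^sub>k\<close> with coefficients \<open>y\<^sub>k\<close>.  Its adjoint \<open>T\<^sup>*\<close> sends \<open>x\<close> to the vector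
  of inner products of \<open>x\<close> with the \<open>e\<^sub>k\<close>.  Expanding the squared norm of \<open>T y - x\<close> shows that
  \<open>R = T\<^sup>* T\<close>, \<open>r = T\<^sup>*\<close> and the identity for \<open>\<rho>\<close> form an expansion of \<open>G\<close>
  (\<open>least_squares_expansion\<close>).

  The operators \<open>R\<close> and \<open>r\<close> of any two expansions agree on vectors and on square integrable
  functions (\<open>expansion_unique\<close>).  At \<open>x = 0\<close> the expansion
  reduces to the quadratic form of \<open>R\<close>, which determines a Hermitian \<open>R\<close> by polarization; the
  values at \<open>y\<close> and at \<open>0\<close> then give the real part of the inner product of \<open>y\<close> with \<open>r x\<close> for
  every \<open>y\<close>, which determines \<open>r x\<close>.  So the operators singled out by the choice operator are
  \<open>T\<^sup>* T\<close> and \<open>T\<^sup>*\<close>, and both component formulas can be read off.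

  The quadratic form of \<open>T\<^sup>* T\<close> at \<open>y\<close> is the squared norm of \<open>T y\<close>, so positive definiteness
  says that no nontrivial combination of the \<open>e\<^sub>k\<close> vanishes almost everywhere on the interval.
  Instead of the identity theorem for analytic functions, an algebraic argument is used
  (\<open>shifted_sincs_independent\<close>): \<open>sin (k * pi + u)\<close> is \<open>sin u\<close> up to sign, so where
  \<open>sin u\<close> does not vanish, every zero \<open>t\<close> of the combination makes \<open>u = \<Omega> * t\<close> a root of the
  numerator of a fixed rational function with at most simple poles at the points \<open>- k * pi\<close>.
  A polynomial with infinitely many roots is zero, and the value of the numerator at such a point
  is a nonzero multiple of the coefficient belonging to that point.

  Finally, a positive definite operator on a finite-dimensional space is bijective
  (\<open>positive_definite_bij\<close>), and completing the square around the solution \<open>z\<close> of \<open>R z = r x\<close>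
  makes \<open>z\<close> the only minimizer (\<open>expansion_minimizer\<close>).
\<close>

section \<open>Hermitian operators on finite vectors\<close>

lemma finite_indices [simp]: "finite (indices N)"
  by (simp add: indices_def)

lemma cvec_lincomb: "y \<in> cvec N \<Longrightarrow> z \<in> cvec N \<Longrightarrow> (\<lambda>k. a * y k + b * z k) \<in> cvec N"
  by (simp add: cvec_def)

lemma cvec_diff: "y \<in> cvec N \<Longrightarrow> z \<in> cvec N \<Longrightarrow> (\<lambda>k. y k - z k) \<in> cvec N"
  by (simp add: cvec_def)

lemma cvec_zero: "(\<lambda>_. 0) \<in> cvec N"
  by (simp add: cvec_def)

lemma unit_cvec_in_cvec: "k \<in> indices N \<Longrightarrow> unit_cvec k \<in> cvec N"
  by (auto simp: cvec_def unit_cvec_def)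

lemma cvec_inner_commute: "cvec_inner N z y = cnj (cvec_inner N y z)"
  by (simp add: cvec_inner_def mult.commute)

lemma cvec_inner_add_left:
  "cvec_inner N (\<lambda>k. y k + z k) w = cvec_inner N y w + cvec_inner N z w"
  by (simp add: cvec_inner_def sum.distrib algebra_simps)

lemma cvec_inner_diff_left:
  "cvec_inner N (\<lambda>k. y k - z k) w = cvec_inner N y w - cvec_inner N z w"
  by (simp add: cvec_inner_def sum_subtractf algebra_simps)

lemma cvec_inner_add_right:
  "cvec_inner N w (\<lambda>k. y k + z k) = cvec_inner N w y + cvec_inner N w z"
  by (simp add: cvec_inner_def sum.distrib algebra_simps)

lemma cvec_inner_diff_right:
  "cvec_inner N w (\<lambda>k. y k - z k) = cvec_inner N w y - cvec_inner N w z"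
  by (simp add: cvec_inner_def sum_subtractf algebra_simps)

lemma cvec_inner_zero_left [simp]: "cvec_inner N (\<lambda>_. 0) y = 0"
  by (simp add: cvec_inner_def)

lemma cvec_inner_zero_right [simp]: "cvec_inner N y (\<lambda>_. 0) = 0"
  by (simp add: cvec_inner_def)

lemma cvec_inner_self: "cvec_inner N y y = complex_of_real (\<Sum>k\<in>indices N. (cmod (y k))\<^sup>2)"
  by (simp only: cvec_inner_def complex_norm_square of_real_sum)

text \<open>Testing against \<open>v - w\<close> itself shows that the real parts alone suffice.\<close>

lemma cvec_eq_if_Re_inner_eq:
  assumes v: "v \<in> cvec N" and w: "w \<in> cvec N"
    and eq: "\<And>y. y \<in> cvec N \<Longrightarrow> Re (cvec_inner N y v) = Re (cvec_inner N y w)"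
  shows "v = w"
proof
  fix k
  have "Re (cvec_inner N (\<lambda>k. v k - w k) (\<lambda>k. v k - w k)) = 0"
    using eq[OF cvec_diff[OF v w]] by (simp only: cvec_inner_diff_right) simp
  then have "(\<Sum>k\<in>indices N. (cmod (v k - w k))\<^sup>2) = 0"
    by (simp add: cvec_inner_self)
  then have "k \<in> indices N \<Longrightarrow> v k = w k"
    by (simp add: sum_nonneg_eq_0_iff)
  then show "v k = w k"
    using v w by (cases "k \<in> indices N") (auto simp: cvec_def)
qed

lemma linear_hermitian_cvec_add:
  assumes "linear_hermitian_cvec N R" "y \<in> cvec N" "z \<in> cvec N"
  shows "R (\<lambda>k. y k + z k) = (\<lambda>k. R y k + R z k)"
proof -
  have "R (\<lambda>k. 1 * y k + 1 * z k) = (\<lambda>k. 1 * R y k + 1 * R z k)"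
    using assms unfolding linear_hermitian_cvec_def by blast
  then show ?thesis by simp
qed

lemma linear_hermitian_cvec_diff:
  assumes "linear_hermitian_cvec N R" "y \<in> cvec N" "z \<in> cvec N"
  shows "R (\<lambda>k. y k - z k) = (\<lambda>k. R y k - R z k)"
proof -
  have "R (\<lambda>k. 1 * y k + (-1) * z k) = (\<lambda>k. 1 * R y k + (-1) * R z k)"
    using assms unfolding linear_hermitian_cvec_def by blast
  then show ?thesis by simp
qed

text \<open>For a Hermitian operator the two cross terms of the quadratic form at \<open>y + z\<close> are complex
  conjugates, so together they make up twice the real part of one of them.\<close>

lemma hermitian_polarization:
  assumes R: "linear_hermitian_cvec N R" and y: "y \<in> cvec N" and z: "z \<in> cvec N"
  shows "2 * Re (cvec_inner N y (R z)) =
    Re (cvec_inner N (\<lambda>k. y k + z k) (R (\<lambda>k. y k + z k)))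
      - Re (cvec_inner N y (R y)) - Re (cvec_inner N z (R z))"
proof -
  have "cvec_inner N z (R y) = cvec_inner N (R z) y"
    using R y z by (simp add: linear_hermitian_cvec_def)
  also have "\<dots> = cnj (cvec_inner N y (R z))"
    by (rule cvec_inner_commute)
  finally have "Re (cvec_inner N z (R y)) = Re (cvec_inner N y (R z))"
    by simp
  then show ?thesis
    by (simp add: linear_hermitian_cvec_add[OF R y z] cvec_inner_add_left cvec_inner_add_right)
qed

lemma hermitian_eq_if_quadratic_form_eq:
  assumes R: "linear_hermitian_cvec N R" and R': "linear_hermitian_cvec N R'"
    and eq: "\<And>y. y \<in> cvec N \<Longrightarrow> cvec_inner N y (R y) = cvec_inner N y (R' y)"
    and z: "z \<in> cvec N"
  shows "R z = R' z"
proof (rule cvec_eq_if_Re_inner_eq)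
  show "R z \<in> cvec N" "R' z \<in> cvec N"
    using R R' z by (auto simp: linear_hermitian_cvec_def)
  fix y assume y: "y \<in> cvec N"
  have "(\<lambda>k. y k + z k) \<in> cvec N"
    using cvec_lincomb[OF y z, of 1 1] by simp
  then have "2 * Re (cvec_inner N y (R z)) = 2 * Re (cvec_inner N y (R' z))"
    using hermitian_polarization[OF R y z] hermitian_polarization[OF R' y z] eq y z by simp
  then show "Re (cvec_inner N y (R z)) = Re (cvec_inner N y (R' z))" by simp
qed

text \<open>The surjectivity of injective endomorphisms is obtained from the dimension theory of vector
  spaces.  As the dimension \<open>2 * N + 1\<close> is a term, \<open>cvec N\<close> is treated as a finitely generated
  subspace of the space of all functions on the integers.\<close>

interpretation complex_functions:
  vector_space "\<lambda>(a::complex) (y::int \<Rightarrow> complex) k. a * y k"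
  by unfold_locales (auto simp: fun_eq_iff algebra_simps)

lemma cvec_subspace: "complex_functions.subspace (cvec N)"
  unfolding complex_functions.subspace_def by (auto simp: cvec_def)

lemma cvec_subset_span_units: "cvec N \<subseteq> complex_functions.span (unit_cvec ` indices N)"
proof
  fix y assume y: "y \<in> cvec N"
  have "y = (\<Sum>m\<in>indices N. (\<lambda>k. y m * unit_cvec m k))"
  proof
    fix k
    have "(\<Sum>m\<in>M. (\<lambda>k. y m * unit_cvec m k)) k = (\<Sum>m\<in>M. y m * unit_cvec m k)" for M
      by (induction M rule: infinite_finite_induct) auto
    then show "y k = (\<Sum>m\<in>indices N. (\<lambda>k. y m * unit_cvec m k)) k"
      using y by (simp add: unit_cvec_def cvec_def if_distrib[of "(*) _"] cong: if_cong)
  qed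
  also have "\<dots> \<in> complex_functions.span (unit_cvec ` indices N)"
    by (intro complex_functions.span_sum complex_functions.span_scale complex_functions.span_base imageI)
  finally show "y \<in> complex_functions.span (unit_cvec ` indices N)" .
qed

text \<open>An injective map sends a basis \<open>B\<close> to an independent set of the same cardinality.  A vector
  outside the span of the image would enlarge this to an independent set with more elements than
  the spanning set \<open>B\<close>.\<close>

lemma injective_cvec_endomorphism_surj:
  assumes maps: "\<And>y. y \<in> cvec N \<Longrightarrow> R y \<in> cvec N"
    and lin: "\<And>a b y z. y \<in> cvec N \<Longrightarrow> z \<in> cvec N \<Longrightarrow>
        R (\<lambda>k. a * y k + b * z k) = (\<lambda>k. a * R y k + b * R z k)"
    and inj: "inj_on R (cvec N)"
  shows "R ` cvec N = cvec N"
proof -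
  interpret pair: vector_space_pair "\<lambda>(a::complex) (y::int \<Rightarrow> complex) k. a * y k"
      "\<lambda>(a::complex) (y::int \<Rightarrow> complex) k. a * y k" ..
  \<comment> \<open>Vector space homomorphisms are total, so \<open>R\<close> is extended by precomposing with truncation.\<close>
  define T where "T y = R (\<lambda>k. if k \<in> indices N then y k else 0)" for y
  have trunc: "(\<lambda>k. if k \<in> indices N then y k else 0) \<in> cvec N" for y :: "int \<Rightarrow> complex"
    by (simp add: cvec_def)
  have T_eq: "T y = R y" if "y \<in> cvec N" for y
  proof -
    have "(\<lambda>k. if k \<in> indices N then y k else 0) = y"
      using that by (auto simp: cvec_def)
    then show ?thesis by (simp add: T_def)
  qed
  have T_lin: "T (\<lambda>k. a * y k + b * z k) = (\<lambda>k. a * T y k + b * T z k)" for a b y z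
  proof -
    have "(\<lambda>k. if k \<in> indices N then a * y k + b * z k else 0) =
      (\<lambda>k. a * (if k \<in> indices N then y k else 0) + b * (if k \<in> indices N then z k else 0))"
      by auto
    then show ?thesis using lin[OF trunc trunc] by (simp add: T_def)
  qed
  have hom: "Vector_Spaces.linear (\<lambda>(a::complex) (y::int \<Rightarrow> complex) k. a * y k)
      (\<lambda>(a::complex) (y::int \<Rightarrow> complex) k. a * y k) T"
  proof
    show "T (y + z) = T y + T z" for y z
      using T_lin[of 1 y 1 z] by (simp add: plus_fun_def)
    show "T (\<lambda>k. a * y k) = (\<lambda>k. a * T y k)" for a y
      using T_lin[of a y 0 y] by simp
  qed
  obtain B where B: "B \<subseteq> cvec N" "complex_functions.independent B"
      "cvec N \<subseteq> complex_functions.span B"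
    using complex_functions.maximal_independent_subset by blast
  have span_B: "complex_functions.span B = cvec N"
    using B complex_functions.span_minimal[OF B(1) cvec_subspace] by blast
  have "B \<subseteq> complex_functions.span (unit_cvec ` indices N)"
    using B(1) cvec_subset_span_units by (rule subset_trans)
  then have finB: "finite B"
    using complex_functions.independent_span_bound[OF finite_imageI[OF finite_indices] B(2)] by blast
  have injT: "inj_on T (cvec N)"
    using inj T_eq by (simp add: inj_on_def)
  have indep: "complex_functions.independent (T ` B)"
    using pair.linear_independent_injective_image[OF hom B(2)] injT span_B by simp
  have TB: "T ` B \<subseteq> cvec N"
    using B(1) T_eq maps by auto
  have span_TB: "complex_functions.span (T ` B) = T ` cvec N"
    using pair.linear_span_image[OF hom, of B] span_B by simp
  have "cvec N \<subseteq> T ` cvec N"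
  proof (rule ccontr)
    assume "\<not> ?thesis"
    then obtain v where v: "v \<in> cvec N" "v \<notin> complex_functions.span (T ` B)"
      using span_TB by auto
    then have ind: "complex_functions.independent (insert v (T ` B))"
      using indep complex_functions.independent_insertI by blast
    have "card (insert v (T ` B)) \<le> card B"
      using complex_functions.independent_span_bound[OF finB ind] v(1) TB span_B by blast
    moreover have "card (T ` B) = card B"
      using injT B(1) by (meson card_image inj_on_subset)
    moreover have "v \<notin> T ` B"
      using v(2) complex_functions.span_base by blast
    ultimately show False
      using finB by simp
  qed
  then show ?thesis
    using T_eq maps image_cong[OF refl T_eq, of "cvec N"] by auto
qed

lemma positive_definite_bij:
  assumes R: "linear_hermitian_cvec N R" and pos: "positive_definite N R"
  shows "bij_betw R (cvec N) (cvec N)"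
proof -
  have inj: "inj_on R (cvec N)"
  proof (rule inj_onI, rule ccontr)
    fix y z assume yz: "y \<in> cvec N" "z \<in> cvec N" "R y = R z" "y \<noteq> z"
    then have "Re (cvec_inner N (\<lambda>k. y k - z k) (R (\<lambda>k. y k - z k))) > 0"
      using pos cvec_diff[OF yz(1,2)] by (auto simp: positive_definite_def fun_eq_iff)
    then show False
      using yz(3) by (simp add: linear_hermitian_cvec_diff[OF R yz(1,2)])
  qed
  have "R ` cvec N = cvec N"
    by (rule injective_cvec_endomorphism_surj[OF _ _ inj])
       (use R in \<open>auto simp: linear_hermitian_cvec_def\<close>)
  then show ?thesis using inj by (simp add: bij_betw_def)
qed

text \<open>Completing the square: at \<open>y\<close> the functional exceeds its value at the critical point \<open>z\<close> by
  the quadratic form of the displacement.\<close>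

lemma quadratic_functional_excess:
  assumes R: "linear_hermitian_cvec N R"
    and y: "y \<in> cvec N" and z: "z \<in> cvec N"
  shows "(Re (cvec_inner N y (R y)) - 2 * Re (cvec_inner N y (R z)))
       - (Re (cvec_inner N z (R z)) - 2 * Re (cvec_inner N z (R z)))
     = Re (cvec_inner N (\<lambda>k. y k - z k) (R (\<lambda>k. y k - z k)))"
proof -
  have "cvec_inner N z (R y) = cnj (cvec_inner N y (R z))"
    using R y z cvec_inner_commute[of N "R z" y] by (simp add: linear_hermitian_cvec_def)
  then have "Re (cvec_inner N z (R y)) = Re (cvec_inner N y (R z))" by simp
  then show ?thesis
    by (simp add: linear_hermitian_cvec_diff[OF R y z] cvec_inner_diff_left cvec_inner_diff_right)
qed

section \<open>Independence and square integrability of shifted sinc functions\<close>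

lemma sinc_pi_shift:
  assumes "sin (u::real) \<noteq> 0"
  shows "sinc (of_int k * pi + u) = cos (of_int k * pi) * sin u / (of_int k * pi + u)"
    and "of_int k * pi + u \<noteq> 0"
proof -
  have s: "sin (of_int k * pi) = 0"
    by (metis sin_int_times_real mult.commute of_real_of_int_eq sin_zero_iff_int2)
  show nz: "of_int k * pi + u \<noteq> 0"
  proof
    assume "of_int k * pi + u = 0"
    then have "u = - (of_int k * pi)" by simp
    then show False using assms s by simp
  qed
  show "sinc (of_int k * pi + u) = cos (of_int k * pi) * sin u / (of_int k * pi + u)"
    using nz s by (simp add: sin_add)
qed

lemma countable_sin_zeros: "countable {t. sin (\<Omega> * t :: real) = 0}" if "\<Omega> \<noteq> 0"
proof (rule countable_subset)
  show "{t. sin (\<Omega> * t) = 0} \<subseteq> range (\<lambda>i::int. of_int i * pi / \<Omega>)"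
    using that by (auto simp: sin_zero_iff_int2 image_iff field_simps)
qed auto

text \<open>Multiplying the vanishing combination by the product of all denominators \<open>j * pi + \<Omega> * t\<close>
  and dividing by \<open>sin (\<Omega> * t)\<close> turns it into a polynomial equation for \<open>\<Omega> * t\<close>.
  Uncountability of \<open>Z\<close> leaves infinitely many points once the countably many zeros of the sine
  have been discarded.\<close>

lemma shifted_sincs_independent:
  fixes c :: "int \<Rightarrow> complex"
  assumes K: "finite K" and \<Omega>: "\<Omega> \<noteq> 0" and Z: "uncountable Z"
    and zero: "\<And>t. t \<in> Z \<Longrightarrow> (\<Sum>k\<in>K. c k * complex_of_real (sinc (of_int k * pi + \<Omega> * t))) = 0"
    and m: "m \<in> K"
  shows "c m = 0"
proof -
  define d where "d k = c k * complex_of_real (cos (of_int k * pi))" for k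
  define P where "P = (\<Sum>k\<in>K. smult (d k) (\<Prod>j\<in>K-{k}. [:complex_of_real (of_int j * pi), 1:]))"
  have P: "poly P u = (\<Sum>k\<in>K. d k * (\<Prod>j\<in>K-{k}. of_real (of_int j * pi) + u))" for u
    by (simp add: P_def poly_sum poly_prod)
  define Z' where "Z' = Z - {t. sin (\<Omega> * t) = 0}"
  have "uncountable Z'"
    unfolding Z'_def using Z countable_sin_zeros[OF \<Omega>] by (rule uncountable_minus_countable)
  then have "infinite Z'"
    using uncountable_infinite by blast
  moreover have "inj_on (\<lambda>t. complex_of_real (\<Omega> * t)) Z'"
    using \<Omega> by (auto simp: inj_on_def)
  ultimately have inf: "infinite ((\<lambda>t. complex_of_real (\<Omega> * t)) ` Z')"
    using finite_imageD by blast
  have "poly P (complex_of_real (\<Omega> * t)) = 0" if t: "t \<in> Z'" for t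
  proof -
    have s: "sin (\<Omega> * t) \<noteq> 0" using t by (simp add: Z'_def)
    define w where "w j = complex_of_real (of_int j * pi + \<Omega> * t)" for j :: int
    have w: "w j \<noteq> 0" for j
      unfolding w_def using sinc_pi_shift(2)[OF s, of j] by (metis of_real_eq_0_iff)
    have summand: "d k * (\<Prod>j\<in>K-{k}. w j) =
        (\<Prod>j\<in>K. w j) / of_real (sin (\<Omega> * t)) * (c k * of_real (sinc (of_int k * pi + \<Omega> * t)))"
      if k: "k \<in> K" for k
    proof -
      have "(\<Prod>j\<in>K. w j) = w k * (\<Prod>j\<in>K-{k}. w j)"
        using K k by (rule prod.remove)
      moreover have "complex_of_real (sinc (of_int k * pi + \<Omega> * t)) =
          of_real (cos (of_int k * pi)) * of_real (sin (\<Omega> * t)) / w k"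
        unfolding sinc_pi_shift(1)[OF s, of k] w_def by simp
      ultimately show ?thesis
        using w[of k] s by (simp add: d_def field_simps)
    qed
    have "poly P (complex_of_real (\<Omega> * t)) = (\<Sum>k\<in>K. d k * (\<Prod>j\<in>K-{k}. w j))"
      unfolding P w_def by simp
    also have "\<dots> = (\<Prod>j\<in>K. w j) / of_real (sin (\<Omega> * t)) *
        (\<Sum>k\<in>K. c k * of_real (sinc (of_int k * pi + \<Omega> * t)))"
      unfolding sum_distrib_left by (rule sum.cong[OF refl summand])
    also have "\<dots> = 0"
      using zero t by (simp add: Z'_def)
    finally show ?thesis .
  qed
  then have "P = 0"
    using inf poly_roots_finite[of P] by (metis (mono_tags, lifting) finite_subset image_subsetI mem_Collect_eq)
  \<comment> \<open>At \<open>- m * pi\<close> every product that contains the factor with index \<open>m\<close> vanishes.\<close>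
  then have "0 = (\<Sum>k\<in>K. d k * (\<Prod>j\<in>K-{k}. of_real (of_int j * pi) + - of_real (of_int m * pi)))"
    using P[of "- of_real (of_int m * pi)"] by simp
  also have "\<dots> = (\<Sum>k\<in>K. if k = m then d m * (\<Prod>j\<in>K-{m}. of_real (of_int j * pi) + - of_real (of_int m * pi)) else 0)"
    using K m by (intro sum.cong) auto
  also have "\<dots> = d m * (\<Prod>j\<in>K-{m}. of_real (of_int j * pi) + - of_real (of_int m * pi))"
    using K m by simp
  finally have "d m = 0"
    using K by auto
  moreover have "cos (of_int m * pi) \<noteq> 0"
    by (metis cos_int_times_real mult.commute of_real_of_int_eq sin_cos_squared_add sin_zero_iff_int2
          zero_neq_one add.right_neutral power_zero_numeral)
  ultimately show ?thesis
    by (simp add: d_def)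
qed

text \<open>Both \<open>(sin u)\<^sup>2 \<le> u\<^sup>2\<close> and \<open>(sin u)\<^sup>2 \<le> 1\<close> enter, the former near the origin and the latter
  far away; the right-hand side is an integrable bound on the whole line, which is what an
  interval unbounded to the left requires.\<close>

lemma sinc_square_le: "(sinc u)\<^sup>2 \<le> 2 * inverse (1 + u\<^sup>2)" for u :: real
proof (cases "u = 0")
  case False
  have "(sin u)\<^sup>2 \<le> u\<^sup>2"
    using abs_sin_x_le_abs_x[of u] abs_le_square_iff by blast
  moreover have "(sin u)\<^sup>2 * u\<^sup>2 \<le> 1 * u\<^sup>2"
    by (intro mult_right_mono) (auto simp: abs_square_le_1)
  ultimately have "(sin u)\<^sup>2 * (1 + u\<^sup>2) \<le> 2 * u\<^sup>2"
    by (simp add: algebra_simps)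
  moreover have "1 + u\<^sup>2 > 0" by (simp add: add_pos_nonneg)
  ultimately show ?thesis
    using False by (simp add: field_simps power_divide)
qed simp

lemma integrable_shifted_sinc_square:
  assumes "\<Omega> \<noteq> 0"
  shows "integrable lborel (\<lambda>t. (sinc (a + \<Omega> * t))\<^sup>2)"
proof (rule Bochner_Integration.integrable_bound)
  have "integrable lborel (\<lambda>u. 2 * inverse (1 + u\<^sup>2 :: real))"
    using integrable_inverse_1_plus_square by (simp add: set_integrable_def)
  then show "integrable lborel (\<lambda>t. 2 * inverse (1 + (a + \<Omega> * t)\<^sup>2))"
    using assms by (rule lborel_integrable_real_affine)
  show "AE t in lborel. norm ((sinc (a + \<Omega> * t))\<^sup>2) \<le> norm (2 * inverse (1 + (a + \<Omega> * t)\<^sup>2))"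
    using sinc_square_le by (intro AE_I2) (smt (verit) real_norm_def zero_le_power2)
qed auto

text \<open>The Fourier transform of a rectangular window is a sinc function.\<close>

lemma LINT_exp_window:
  assumes "\<Omega> > 0"
  shows "(LINT \<omega>|lebesgue. indicator {\<omega>. \<bar>\<omega>\<bar> \<le> \<Omega>} \<omega> * exp (\<i> * complex_of_real (\<omega> * u))) =
    complex_of_real (2 * \<Omega> * sinc (\<Omega> * u))"
proof -
  have I: "{\<omega>. \<bar>\<omega>\<bar> \<le> \<Omega>} = {-\<Omega>..\<Omega>}" by auto
  have "(LINT \<omega>|lebesgue. indicator {\<omega>. \<bar>\<omega>\<bar> \<le> \<Omega>} \<omega> * exp (\<i> * complex_of_real (\<omega> * u))) =
      (LINT \<omega>|lborel. indicator {-\<Omega>..\<Omega>} \<omega> *\<^sub>R exp (\<i> * complex_of_real (\<omega> * u)))"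
    unfolding I by (subst integral_completion)
      (auto simp: scaleR_conv_of_real of_real_indicator intro!: borel_measurable_continuous_onI continuous_intros)
  also have "\<dots> = complex_of_real (2 * \<Omega> * sinc (\<Omega> * u))"
  proof (cases "u = 0")
    case True
    then have "(LINT \<omega>|lborel. indicator {-\<Omega>..\<Omega>} \<omega> *\<^sub>R exp (\<i> * complex_of_real (\<omega> * u))) =
        complex_of_real \<Omega> - complex_of_real (-\<Omega>)"
      using assms by (intro integral_FTC_atLeastAtMost)
        (auto intro!: derivative_eq_intros continuous_intros simp: has_vector_derivative_def scaleR_conv_of_real)
    then show ?thesis using True by simp
  next
    case False
    define A where "A = \<i> * complex_of_real u"
    have A: "A \<noteq> 0" using False by (simp add: A_def)
    have e: "exp (\<i> * complex_of_real (\<omega> * u)) = exp (\<omega> *\<^sub>R A)" for \<omega>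
      by (simp add: A_def scaleR_conv_of_real mult_ac)
    have "((\<lambda>\<omega>. exp (\<omega> *\<^sub>R A) * (1 / A)) has_vector_derivative exp (\<omega> *\<^sub>R A)) (at \<omega> within S)" for \<omega> S
      using has_vector_derivative_mult_left[OF exp_scaleR_has_vector_derivative_right[of A \<omega> S], of "1 / A"] A
      by simp
    then have "(LINT \<omega>|lborel. indicator {-\<Omega>..\<Omega>} \<omega> *\<^sub>R exp (\<omega> *\<^sub>R A)) =
        exp (\<Omega> *\<^sub>R A) * (1 / A) - exp ((-\<Omega>) *\<^sub>R A) * (1 / A)"
      using assms by (intro integral_FTC_atLeastAtMost) (auto intro!: continuous_intros)
    also have "\<dots> = (cis (\<Omega> * u) - cis (- (\<Omega> * u))) / A"
      by (simp add: A_def cis_conv_exp scaleR_conv_of_real diff_divide_distrib mult_ac)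
    also have "cis (\<Omega> * u) - cis (- (\<Omega> * u)) = 2 * \<i> * complex_of_real (sin (\<Omega> * u))"
      by (simp add: complex_eq_iff)
    also have "\<dots> / A = complex_of_real (2 * \<Omega> * sinc (\<Omega> * u))"
      using False assms by (simp add: A_def)
    finally show ?thesis unfolding e .
  qed
  finally show ?thesis .
qed

lemma Q_eq_sincs:
  assumes "\<Omega> > 0"
  shows "Q \<Omega> N y t = (\<Sum>k\<in>indices N. y k * complex_of_real (\<Omega> / pi * sinc (of_int k * pi + \<Omega> * t)))"
proof -
  let ?w = "indicator {\<omega>. \<bar>\<omega>\<bar> \<le> \<Omega>} :: real \<Rightarrow> complex"
  let ?u = "\<lambda>k. of_int k * pi / \<Omega> + t"
  have int: "integrable lebesgue (\<lambda>\<omega>. ?w \<omega> * exp (\<i> * complex_of_real (\<omega> * u)))" for u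
  proof -
    have I: "{\<omega>. \<bar>\<omega>\<bar> \<le> \<Omega>} = {-\<Omega>..\<Omega>}" by auto
    have "set_integrable lborel {-\<Omega>..\<Omega>} (\<lambda>\<omega>. exp (\<i> * complex_of_real (\<omega> * u)))"
      by (intro borel_integrable_atLeastAtMost' continuous_intros)
    then show ?thesis
      unfolding I set_integrable_def
      by (subst integrable_completion) (auto simp: scaleR_conv_of_real of_real_indicator
          dest: borel_measurable_integrable)
  qed
  have "spectrum \<Omega> N y \<omega> * exp (\<i> * complex_of_real (\<omega> * t)) =
      (\<Sum>k\<in>indices N. y k * (?w \<omega> * exp (\<i> * complex_of_real (\<omega> * ?u k))))" for \<omega>
    unfolding spectrum_def sum_distrib_right
    by (intro sum.cong refl) (simp add: ring_distribs exp_add mult_ac)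
  then have "Q \<Omega> N y t = 1 / (2 * complex_of_real pi) *
      (\<Sum>k\<in>indices N. y k * (LINT \<omega>|lebesgue. ?w \<omega> * exp (\<i> * complex_of_real (\<omega> * ?u k))))"
    unfolding Q_def inverse_fourier_def by (simp add: int del: of_real_mult of_real_add)
  also have "\<dots> = (\<Sum>k\<in>indices N. y k * complex_of_real (\<Omega> / pi * sinc (\<Omega> * ?u k)))"
    unfolding LINT_exp_window[OF assms] sum_distrib_left
    by (intro sum.cong refl) (simp add: field_simps)
  also have "\<dots> = (\<Sum>k\<in>indices N. y k * complex_of_real (\<Omega> / pi * sinc (of_int k * pi + \<Omega> * t)))"
  proof -
    have "\<Omega> * ?u k = of_int k * pi + \<Omega> * t" for k :: int
      using assms by (simp add: field_simps)
    then show ?thesis by (simp only:)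
  qed
  finally show ?thesis .
qed

section \<open>The inner product on square integrable functions\<close>

lemma L2_restrict:
  assumes x: "x \<in> L2 UNIV" and A: "A \<in> sets lebesgue"
  shows "x \<in> L2 A"
proof -
  have m: "x \<in> borel_measurable lebesgue" and i: "integrable lebesgue (\<lambda>t. (cmod (x t))\<^sup>2)"
    using x by (auto simp: L2_def lebesgue_on_UNIV_eq)
  have "integrable (lebesgue_on A) (\<lambda>t. (cmod (x t))\<^sup>2)"
    using A integrable_mult_indicator[OF A i] by (simp add: integrable_restrict_space)
  then show ?thesis
    using measurable_restrict_space1[OF m] by (simp add: L2_def)
qed

lemma L2_lincomb:
  assumes "x \<in> L2 A" "z \<in> L2 A"
  shows "(\<lambda>t. a * x t + b * z t) \<in> L2 A"
proof -
  have m [measurable]: "x \<in> borel_measurable (lebesgue_on A)" "z \<in> borel_measurable (lebesgue_on A)"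
    and i: "integrable (lebesgue_on A) (\<lambda>t. (cmod (x t))\<^sup>2)"
      "integrable (lebesgue_on A) (\<lambda>t. (cmod (z t))\<^sup>2)"
    using assms by (auto simp: L2_def)
  have bound: "(cmod (u + v))\<^sup>2 \<le> 2 * (cmod u)\<^sup>2 + 2 * (cmod v)\<^sup>2" for u v
  proof -
    have "(cmod (u + v))\<^sup>2 \<le> (cmod u + cmod v)\<^sup>2"
      by (intro power_mono norm_triangle_ineq) auto
    also have "\<dots> \<le> 2 * (cmod u)\<^sup>2 + 2 * (cmod v)\<^sup>2"
      using zero_le_power2[of "cmod u - cmod v"] by (simp add: power2_eq_square algebra_simps)
    finally show ?thesis .
  qed
  have "integrable (lebesgue_on A) (\<lambda>t. (cmod (a * x t + b * z t))\<^sup>2)"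
  proof (rule Bochner_Integration.integrable_bound)
    show "integrable (lebesgue_on A)
        (\<lambda>t. 2 * (cmod a)\<^sup>2 * (cmod (x t))\<^sup>2 + 2 * (cmod b)\<^sup>2 * (cmod (z t))\<^sup>2)"
      using i by simp
    show "AE t in lebesgue_on A. norm ((cmod (a * x t + b * z t))\<^sup>2) \<le>
        norm (2 * (cmod a)\<^sup>2 * (cmod (x t))\<^sup>2 + 2 * (cmod b)\<^sup>2 * (cmod (z t))\<^sup>2)"
      using bound[of "a * x t" "b * z t" for t]
      by (intro AE_I2) (simp add: norm_mult power_mult_distrib mult.assoc)
  qed simp
  then show ?thesis by (simp add: L2_def)
qed

lemma L2_zero: "(\<lambda>_. 0) \<in> L2 A"
  by (simp add: L2_def)

lemma L2_diff: "x \<in> L2 A \<Longrightarrow> z \<in> L2 A \<Longrightarrow> (\<lambda>t. x t - z t) \<in> L2 A"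
  using L2_lincomb[of x A z 1 "-1"] by simp

lemma L2_sum:
  assumes "finite K" "\<And>k. k \<in> K \<Longrightarrow> e k \<in> L2 A"
  shows "(\<lambda>t. \<Sum>k\<in>K. y k * e k t) \<in> L2 A"
  using assms
proof (induction K rule: finite_induct)
  case (insert k K)
  then have "(\<lambda>t. y k * e k t + 1 * (\<Sum>k\<in>K. y k * e k t)) \<in> L2 A"
    by (intro L2_lincomb) auto
  then show ?case using insert by simp
qed (simp add: L2_zero)

lemma L2_integrable_mult_cnj:
  assumes "x \<in> L2 A" "z \<in> L2 A"
  shows "integrable (lebesgue_on A) (\<lambda>t. x t * cnj (z t))"
proof (rule Bochner_Integration.integrable_bound)
  have m [measurable]: "x \<in> borel_measurable (lebesgue_on A)" "z \<in> borel_measurable (lebesgue_on A)"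
    using assms by (auto simp: L2_def)
  have "(\<lambda>t. cnj (z t)) \<in> borel_measurable (lebesgue_on A)"
    using m(2) by (rule measurable_compose)
      (intro borel_measurable_continuous_onI continuous_on_cnj continuous_on_id)
  then show "(\<lambda>t. x t * cnj (z t)) \<in> borel_measurable (lebesgue_on A)"
    using m(1) by (intro borel_measurable_times)
  show "integrable (lebesgue_on A) (\<lambda>t. (cmod (x t))\<^sup>2 + (cmod (z t))\<^sup>2)"
    using assms by (simp add: L2_def)
  show "AE t in lebesgue_on A. norm (x t * cnj (z t)) \<le> norm ((cmod (x t))\<^sup>2 + (cmod (z t))\<^sup>2)"
  proof (intro AE_I2)
    fix t
    have "2 * (cmod (x t) * cmod (z t)) \<le> (cmod (x t))\<^sup>2 + (cmod (z t))\<^sup>2"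
      using sum_squares_bound[of "cmod (x t)" "cmod (z t)"] by simp
    moreover have "0 \<le> cmod (x t) * cmod (z t)" by simp
    ultimately have "cmod (x t) * cmod (z t) \<le> (cmod (x t))\<^sup>2 + (cmod (z t))\<^sup>2"
      by linarith
    then show "norm (x t * cnj (z t)) \<le> norm ((cmod (x t))\<^sup>2 + (cmod (z t))\<^sup>2)"
      by (simp add: norm_mult)
  qed
qed

lemma L2_inner_commute: "L2_inner A z x = cnj (L2_inner A x z)"
  by (simp add: L2_inner_def mult.commute flip: Bochner_Integration.integral_cnj)

lemma L2_inner_self: "L2_inner A x x = complex_of_real (LINT t|lebesgue_on A. (cmod (x t))\<^sup>2)"
  unfolding L2_inner_def by (simp only: complex_norm_square[symmetric] integral_complex_of_real)

lemma L2_inner_lincomb_left: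
  assumes "x \<in> L2 A" "z \<in> L2 A" "w \<in> L2 A"
  shows "L2_inner A (\<lambda>t. a * x t + b * z t) w = a * L2_inner A x w + b * L2_inner A z w"
  using L2_integrable_mult_cnj[OF assms(1,3)] L2_integrable_mult_cnj[OF assms(2,3)]
  by (simp add: L2_inner_def distrib_right mult.assoc)

lemma L2_inner_diff_left:
  assumes "x \<in> L2 A" "z \<in> L2 A" "w \<in> L2 A"
  shows "L2_inner A (\<lambda>t. x t - z t) w = L2_inner A x w - L2_inner A z w"
  using L2_inner_lincomb_left[OF assms, of 1 "-1"] by simp

lemma L2_inner_diff_self:
  assumes f: "f \<in> L2 A" and x: "x \<in> L2 A"
  shows "L2_inner A (\<lambda>t. f t - x t) (\<lambda>t. f t - x t) =
    L2_inner A f f - 2 * complex_of_real (Re (L2_inner A f x)) + L2_inner A x x"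
proof -
  have d: "(\<lambda>t. f t - x t) \<in> L2 A" using f x by (rule L2_diff)
  have right: "L2_inner A w (\<lambda>t. f t - x t) = L2_inner A w f - L2_inner A w x" if "w \<in> L2 A" for w
    using L2_inner_diff_left[OF f x that] L2_inner_commute[of A w] by simp
  have "L2_inner A x f = cnj (L2_inner A f x)" by (rule L2_inner_commute)
  then show ?thesis
    by (simp add: L2_inner_diff_left[OF f x d] right f x complex_eq_iff)
qed

text \<open>Needed for the boundedness of \<open>r\<close>; it is inherited from the Cauchy-Schwarz inequality for
  nonnegative integrals of the absolute values.\<close>

lemma L2_Cauchy_Schwarz:
  assumes x: "x \<in> L2 A" and z: "z \<in> L2 A"
  shows "cmod (L2_inner A x z) \<le> L2_norm A x * L2_norm A z"
proof -
  let ?M = "lebesgue_on A"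
  have [measurable]: "x \<in> borel_measurable ?M" "z \<in> borel_measurable ?M"
    and i: "integrable ?M (\<lambda>t. (cmod (x t))\<^sup>2)" "integrable ?M (\<lambda>t. (cmod (z t))\<^sup>2)"
    using x z by (auto simp: L2_def)
  have j: "integrable ?M (\<lambda>t. cmod (x t) * cmod (z t))"
    using integrable_norm[OF L2_integrable_mult_cnj[OF x z]] by (simp add: norm_mult)
  have "(\<integral>\<^sup>+t. ennreal (cmod (x t)) * ennreal (cmod (z t)) \<partial>?M)\<^sup>2 \<le>
      (\<integral>\<^sup>+t. ennreal (cmod (x t)) ^ 2 \<partial>?M) * (\<integral>\<^sup>+t. ennreal (cmod (z t)) ^ 2 \<partial>?M)"
    by (rule Cauchy_Schwarz_nn_integral) measurable
  then have "ennreal ((LINT t|?M. cmod (x t) * cmod (z t))\<^sup>2) \<le>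
      ennreal ((LINT t|?M. (cmod (x t))\<^sup>2) * (LINT t|?M. (cmod (z t))\<^sup>2))"
    by (simp add: ennreal_mult[symmetric] ennreal_power nn_integral_eq_integral i j)
  then have "(LINT t|?M. cmod (x t) * cmod (z t))\<^sup>2 \<le>
      (LINT t|?M. (cmod (x t))\<^sup>2) * (LINT t|?M. (cmod (z t))\<^sup>2)"
    by (subst (asm) ennreal_le_iff) auto
  then have "(LINT t|?M. cmod (x t) * cmod (z t)) \<le> L2_norm A x * L2_norm A z"
    unfolding L2_norm_def real_sqrt_mult[symmetric] by (rule real_le_rsqrt)
  moreover have "cmod (L2_inner A x z) \<le> (LINT t|?M. cmod (x t) * cmod (z t))"
    unfolding L2_inner_def using integral_norm_bound[of ?M "\<lambda>t. x t * cnj (z t)"]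
    by (simp add: norm_mult)
  ultimately show ?thesis by linarith
qed

section \<open>Least squares with a finite family of functions\<close>

definition synthesis :: "nat \<Rightarrow> (int \<Rightarrow> real \<Rightarrow> complex) \<Rightarrow> (int \<Rightarrow> complex) \<Rightarrow> real \<Rightarrow> complex" where
  "synthesis N e y t = (\<Sum>k\<in>indices N. y k * e k t)"

definition analysis ::
    "real set \<Rightarrow> nat \<Rightarrow> (int \<Rightarrow> real \<Rightarrow> complex) \<Rightarrow> (real \<Rightarrow> complex) \<Rightarrow> int \<Rightarrow> complex" where
  "analysis A N e x k = (if k \<in> indices N then L2_inner A x (e k) else 0)"

lemma synthesis_L2: "(\<And>k. k \<in> indices N \<Longrightarrow> e k \<in> L2 A) \<Longrightarrow> synthesis N e y \<in> L2 A"
  unfolding synthesis_def by (rule L2_sum) auto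

lemma synthesis_lincomb:
  "synthesis N e (\<lambda>k. a * y k + b * z k) = (\<lambda>t. a * synthesis N e y t + b * synthesis N e z t)"
  by (simp add: synthesis_def fun_eq_iff sum.distrib sum_distrib_left algebra_simps)

lemma synthesis_unit_cvec: "m \<in> indices N \<Longrightarrow> synthesis N e (unit_cvec m) = e m"
  by (simp add: synthesis_def unit_cvec_def fun_eq_iff if_distrib[of "\<lambda>c. c * _"] cong: if_cong)

lemma analysis_cvec: "analysis A N e x \<in> cvec N"
  by (simp add: analysis_def cvec_def)

text \<open>This turns both the quadratic and the mixed term of the squared distance between a synthesized
  function and \<open>x\<close> into inner products of coefficient vectors.\<close>

lemma synthesis_analysis_adjoint:
  assumes e: "\<And>k. k \<in> indices N \<Longrightarrow> e k \<in> L2 A" and x: "x \<in> L2 A"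
  shows "L2_inner A (synthesis N e y) x = cvec_inner N y (analysis A N e x)"
proof -
  have "L2_inner A (synthesis N e y) x = (LINT t|lebesgue_on A. (\<Sum>k\<in>indices N. y k * (e k t * cnj (x t))))"
    by (simp add: L2_inner_def synthesis_def sum_distrib_right mult.assoc)
  also have "\<dots> = (\<Sum>k\<in>indices N. y k * L2_inner A (e k) x)"
    using L2_integrable_mult_cnj[OF e x] by (simp add: L2_inner_def)
  also have "\<dots> = cvec_inner N y (analysis A N e x)"
    unfolding cvec_inner_def analysis_def
    by (intro sum.cong refl) (simp add: L2_inner_commute[of A x])
  finally show ?thesis .
qed

lemma analysis_lincomb:
  assumes e: "\<And>k. k \<in> indices N \<Longrightarrow> e k \<in> L2 A" and "x \<in> L2 A" "z \<in> L2 A"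
  shows "analysis A N e (\<lambda>t. a * x t + b * z t) = (\<lambda>k. a * analysis A N e x k + b * analysis A N e z k)"
  using assms by (auto simp: analysis_def fun_eq_iff L2_inner_lincomb_left)

lemma analysis_bounded:
  assumes e: "\<And>k. k \<in> indices N \<Longrightarrow> e k \<in> L2 A" and x: "x \<in> L2 A"
  shows "cvec_norm N (analysis A N e x) \<le> sqrt (\<Sum>k\<in>indices N. (L2_norm A (e k))\<^sup>2) * L2_norm A x"
proof -
  have nn: "0 \<le> L2_norm A x" by (simp add: L2_norm_def)
  have "(\<Sum>k\<in>indices N. (cmod (analysis A N e x k))\<^sup>2) \<le> (\<Sum>k\<in>indices N. (L2_norm A x * L2_norm A (e k))\<^sup>2)"
    using L2_Cauchy_Schwarz[OF x e] by (intro sum_mono power_mono) (auto simp: analysis_def)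
  also have "\<dots> = (\<Sum>k\<in>indices N. (L2_norm A (e k))\<^sup>2) * (L2_norm A x)\<^sup>2"
    by (simp add: power_mult_distrib sum_distrib_left mult.commute)
  finally show ?thesis
    using nn real_sqrt_le_mono by (fastforce simp: cvec_norm_def real_sqrt_mult)
qed

lemma least_squares_expansion:
  assumes e: "\<And>k. k \<in> indices N \<Longrightarrow> e k \<in> L2 A" and Q: "\<And>y. Q \<Omega> N y = synthesis N e y"
  shows "is_expansion \<Omega> N A (\<lambda>y. analysis A N e (synthesis N e y)) (analysis A N e) (\<lambda>x. x)"
proof -
  have T: "synthesis N e y \<in> L2 A" for y
    using e by (rule synthesis_L2)
  have adj: "L2_inner A (synthesis N e y) x = cvec_inner N y (analysis A N e x)" if "x \<in> L2 A" for x y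
    using e that by (rule synthesis_analysis_adjoint)
  have lin: "analysis A N e (\<lambda>t. a * x t + b * z t) = (\<lambda>k. a * analysis A N e x k + b * analysis A N e z k)"
    if "x \<in> L2 A" "z \<in> L2 A" for a b x z
    using e that by (rule analysis_lincomb)
  have bounded: "cvec_norm N (analysis A N e x) \<le> sqrt (\<Sum>k\<in>indices N. (L2_norm A (e k))\<^sup>2) * L2_norm A x"
    if "x \<in> L2 A" for x
    using e that by (rule analysis_bounded)
  have "linear_hermitian_cvec N (\<lambda>y. analysis A N e (synthesis N e y))"
    unfolding linear_hermitian_cvec_def
  proof (intro conjI ballI allI)
    fix y z
    have "cvec_inner N (analysis A N e (synthesis N e y)) z = cnj (L2_inner A (synthesis N e z) (synthesis N e y))"
      by (simp add: adj T cvec_inner_commute[of N z])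
    also have "\<dots> = L2_inner A (synthesis N e y) (synthesis N e z)"
      by (rule L2_inner_commute[symmetric])
    also have "\<dots> = cvec_inner N y (analysis A N e (synthesis N e z))"
      by (rule adj[OF T])
    finally show "cvec_inner N (analysis A N e (synthesis N e y)) z =
        cvec_inner N y (analysis A N e (synthesis N e z))" .
  qed (simp_all add: analysis_cvec synthesis_lincomb lin T)
  moreover have "bounded_linear_L2_cvec A N (analysis A N e)"
    unfolding bounded_linear_L2_cvec_def
    using analysis_cvec lin bounded by blast
  moreover have "bounded_linear_hermitian_L2 A (\<lambda>x. x)"
    unfolding bounded_linear_hermitian_L2_def by (auto intro: exI[of _ 1])
  moreover have "complex_of_real (G \<Omega> N A y x) =
      cvec_inner N y (analysis A N e (synthesis N e y))
        - 2 * complex_of_real (Re (cvec_inner N y (analysis A N e x))) + L2_inner A x x"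
    if "x \<in> L2 A" for x y
    using L2_inner_diff_self[OF T[of y] that]
    by (simp add: G_def Q adj T that flip: L2_inner_self)
  ultimately show ?thesis
    unfolding is_expansion_def by blast
qed

text \<open>Linearity forces \<open>r\<close> to vanish at \<open>0\<close>, so only the quadratic term survives there.\<close>

lemma expansion_at_zero:
  assumes ex: "is_expansion \<Omega> N A R r \<rho>" and y: "y \<in> cvec N"
  shows "cvec_inner N y (R y) = complex_of_real (G \<Omega> N A y (\<lambda>_. 0))"
proof -
  have "r (\<lambda>t. 0 * 0 + 0 * 0) = (\<lambda>k. 0 * r (\<lambda>_. 0) k + 0 * r (\<lambda>_. 0) k)"
    using ex L2_zero[of A] unfolding is_expansion_def bounded_linear_L2_cvec_def
    by (elim conjE allE[of _ 0] ballE[of _ _ "\<lambda>_. 0"]) auto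
  then have "r (\<lambda>_. 0) = (\<lambda>_. 0)" by simp
  moreover have "complex_of_real (G \<Omega> N A y (\<lambda>_. 0)) =
      cvec_inner N y (R y) - 2 * complex_of_real (Re (cvec_inner N y (r (\<lambda>_. 0)))) + L2_inner A (\<rho> (\<lambda>_. 0)) (\<lambda>_. 0)"
    using ex y L2_zero unfolding is_expansion_def by blast
  moreover have "L2_inner A (\<rho> (\<lambda>_. 0)) (\<lambda>_. 0) = 0"
    by (simp add: L2_inner_def)
  ultimately show ?thesis by simp
qed

text \<open>The term with \<open>\<rho>\<close> is the value of \<open>G\<close> at \<open>y = 0\<close>, and the quadratic term is its value at
  \<open>x = 0\<close>; the mixed term is what remains.\<close>

lemma expansion_Re_inner:
  assumes ex: "is_expansion \<Omega> N A R r \<rho>" and y: "y \<in> cvec N" and x: "x \<in> L2 A"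
  shows "2 * Re (cvec_inner N y (r x)) = G \<Omega> N A y (\<lambda>_. 0) + G \<Omega> N A (\<lambda>_. 0) x - G \<Omega> N A y x"
proof -
  have exp: "complex_of_real (G \<Omega> N A y x) =
      cvec_inner N y (R y) - 2 * complex_of_real (Re (cvec_inner N y (r x))) + L2_inner A (\<rho> x) x"
    if "y \<in> cvec N" for y
    using ex that x unfolding is_expansion_def by blast
  have "G \<Omega> N A y x = G \<Omega> N A y (\<lambda>_. 0) - 2 * Re (cvec_inner N y (r x)) + Re (L2_inner A (\<rho> x) x)"
    using arg_cong[OF exp[OF y], of Re] expansion_at_zero[OF ex y] by simp
  moreover have "G \<Omega> N A (\<lambda>_. 0) x = Re (L2_inner A (\<rho> x) x)"
    using arg_cong[OF exp[OF cvec_zero], of Re] by simp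
  ultimately show ?thesis by simp
qed

lemma expansion_unique:
  assumes ex: "is_expansion \<Omega> N A R r \<rho>" and ex': "is_expansion \<Omega> N A R' r' \<rho>'"
  shows "y \<in> cvec N \<Longrightarrow> R y = R' y" and "x \<in> L2 A \<Longrightarrow> r x = r' x"
proof -
  show "R y = R' y" if "y \<in> cvec N"
    using ex ex' that expansion_at_zero[OF ex] expansion_at_zero[OF ex']
    by (intro hermitian_eq_if_quadratic_form_eq) (auto simp: is_expansion_def)
  show "r x = r' x" if x: "x \<in> L2 A"
  proof (rule cvec_eq_if_Re_inner_eq)
    show "r x \<in> cvec N" "r' x \<in> cvec N"
      using ex ex' x by (auto simp: is_expansion_def bounded_linear_L2_cvec_def)
    show "Re (cvec_inner N y (r x)) = Re (cvec_inner N y (r' x))" if "y \<in> cvec N" for y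
      using expansion_Re_inner[OF ex that x] expansion_Re_inner[OF ex' that x] by simp
  qed
qed

text \<open>The choice operator picks components of possibly different expansions; by uniqueness any
  expansion at hand computes both of them on the spaces concerned.\<close>

lemma opR_opr_eq:
  assumes ex: "is_expansion \<Omega> N A R r \<rho>"
  shows "y \<in> cvec N \<Longrightarrow> opR \<Omega> N A y = R y" and "x \<in> L2 A \<Longrightarrow> opr \<Omega> N A x = r x"
proof -
  have "\<exists>R r \<rho>. is_expansion \<Omega> N A R r \<rho>" and "\<exists>r R \<rho>. is_expansion \<Omega> N A R r \<rho>"
    using ex by blast+
  then obtain r1 \<rho>1 R2 \<rho>2 where "is_expansion \<Omega> N A (opR \<Omega> N A) r1 \<rho>1"
      and "is_expansion \<Omega> N A R2 (opr \<Omega> N A) \<rho>2"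
    using someI_ex[of "\<lambda>R. \<exists>r \<rho>. is_expansion \<Omega> N A R r \<rho>"]
      someI_ex[of "\<lambda>r. \<exists>R \<rho>. is_expansion \<Omega> N A R r \<rho>"]
    unfolding opR_def opr_def by blast
  then show "y \<in> cvec N \<Longrightarrow> opR \<Omega> N A y = R y" "x \<in> L2 A \<Longrightarrow> opr \<Omega> N A x = r x"
    using expansion_unique ex by blast+
qed

lemma expansion_minimizer:
  assumes ex: "is_expansion \<Omega> N A R r \<rho>" and pos: "positive_definite N R" and x: "x \<in> L2 A"
    and z: "z \<in> cvec N" and Rz: "R z = r x"
  shows "is_arg_min (\<lambda>y. G \<Omega> N A y x) (\<lambda>y. y \<in> cvec N) y \<longleftrightarrow> y = z"
proof -
  have R: "linear_hermitian_cvec N R" using ex by (simp add: is_expansion_def)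
  have G: "G \<Omega> N A y x = Re (cvec_inner N y (R y)) - 2 * Re (cvec_inner N y (R z)) + Re (L2_inner A (\<rho> x) x)"
    if "y \<in> cvec N" for y
  proof -
    have "complex_of_real (G \<Omega> N A y x) =
        cvec_inner N y (R y) - 2 * complex_of_real (Re (cvec_inner N y (r x))) + L2_inner A (\<rho> x) x"
      using ex that x unfolding is_expansion_def by blast
    from arg_cong[OF this, of Re] show ?thesis by (simp add: Rz)
  qed
  have less: "G \<Omega> N A z x < G \<Omega> N A y x" if y: "y \<in> cvec N" "y \<noteq> z" for y
  proof -
    have "Re (cvec_inner N (\<lambda>k. y k - z k) (R (\<lambda>k. y k - z k))) > 0"
      using pos cvec_diff[OF y(1) z] y(2) by (auto simp: positive_definite_def fun_eq_iff)
    then show ?thesis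
      using quadratic_functional_excess[OF R y(1) z] G[OF y(1)] G[OF z] by simp
  qed
  show ?thesis
  proof
    assume "is_arg_min (\<lambda>y. G \<Omega> N A y x) (\<lambda>y. y \<in> cvec N) y"
    then show "y = z" using less[of y] z by (auto simp: is_arg_min_def)
  next
    assume "y = z"
    then show "is_arg_min (\<lambda>y. G \<Omega> N A y x) (\<lambda>y. y \<in> cvec N) y"
      using less z by (auto simp: is_arg_min_def dest: less_asym)
  qed
qed

text \<open>The quadratic form is the squared norm of the synthesized function, which vanishes only if
  the function is zero almost everywhere.\<close>

lemma Gram_positive_definite:
  assumes e: "\<And>k. k \<in> indices N \<Longrightarrow> e k \<in> L2 A"
    and indep: "\<And>y. y \<in> cvec N \<Longrightarrow> AE t in lebesgue_on A. synthesis N e y t = 0 \<Longrightarrow> y = (\<lambda>_. 0)"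
  shows "positive_definite N (\<lambda>y. analysis A N e (synthesis N e y))"
  unfolding positive_definite_def
proof (intro ballI impI)
  fix y assume y: "y \<in> cvec N" "y \<noteq> (\<lambda>_. 0)"
  let ?n = "LINT t|lebesgue_on A. (cmod (synthesis N e y t))\<^sup>2"
  have T: "synthesis N e y \<in> L2 A" using e by (rule synthesis_L2)
  have "?n \<noteq> 0"
  proof
    assume "?n = 0"
    then have "AE t in lebesgue_on A. (cmod (synthesis N e y t))\<^sup>2 = 0"
      using T by (subst (asm) integral_nonneg_eq_0_iff_AE) (auto simp: L2_def)
    then show False using indep[OF y(1)] y(2) by simp
  qed
  moreover have "?n \<ge> 0" by simp
  ultimately have "?n > 0" by linarith
  moreover have "cvec_inner N y (analysis A N e (synthesis N e y)) = complex_of_real ?n"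
    by (simp only: synthesis_analysis_adjoint[OF e T, symmetric] L2_inner_self)
  ultimately show "cvec_inner N y (analysis A N e (synthesis N e y)) \<in> \<real> \<and>
      Re (cvec_inner N y (analysis A N e (synthesis N e y))) > 0"
    by simp
qed

section \<open>The sinc family on an interval\<close>

definition sinc_kernel :: "real \<Rightarrow> int \<Rightarrow> real \<Rightarrow> complex" where
  "sinc_kernel \<Omega> k t = complex_of_real (\<Omega> / pi * sinc (of_int k * pi + \<Omega> * t))"

lemma Q_eq_synthesis: "\<Omega> > 0 \<Longrightarrow> Q \<Omega> N y = synthesis N (sinc_kernel \<Omega>) y"
  by (rule ext) (simp only: Q_eq_sincs synthesis_def sinc_kernel_def)

lemma sinc_kernel_L2:
  assumes "\<Omega> > 0" "A \<in> sets lebesgue"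
  shows "sinc_kernel \<Omega> k \<in> L2 A"
proof (rule L2_restrict)
  have m: "sinc_kernel \<Omega> k \<in> borel_measurable borel"
    unfolding sinc_kernel_def by measurable
  have "integrable lborel (\<lambda>t. (\<Omega> / pi)\<^sup>2 * (sinc (of_int k * pi + \<Omega> * t))\<^sup>2)"
    by (intro integrable_mult_right integrable_shifted_sinc_square) (use assms in auto)
  then have "integrable lborel (\<lambda>t. (cmod (sinc_kernel \<Omega> k t))\<^sup>2)"
    by (simp only: sinc_kernel_def norm_of_real power2_abs power_mult_distrib)
  then have "integrable lebesgue (\<lambda>t. (cmod (sinc_kernel \<Omega> k t))\<^sup>2)"
    using m by (subst integrable_completion) auto
  moreover have "sinc_kernel \<Omega> k \<in> borel_measurable lebesgue"
    using m by (simp add: measurable_completion)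
  ultimately show "sinc_kernel \<Omega> k \<in> L2 UNIV"
    by (simp add: L2_def lebesgue_on_UNIV_eq)
qed fact

text \<open>Countable sets are null, nonempty open sets are not.\<close>

lemma AE_lebesgue_on_open_uncountable:
  assumes A: "open A" "A \<noteq> {}" and P: "AE t in lebesgue_on A. P t"
  shows "uncountable {t \<in> A. P t}"
proof
  assume c: "countable {t \<in> A. P t}"
  have Al: "A \<in> sets lebesgue" using A by auto
  have "AE t in lebesgue. t \<in> A \<longrightarrow> P t"
    using P Al by (simp add: AE_restrict_space_iff)
  moreover have "AE t in lebesgue. t \<notin> {t \<in> A. P t}"
    using countable_imp_null_set_lborel[OF c] by (intro AE_not_in) (simp add: null_sets_completionI)
  ultimately have "AE t in lebesgue. t \<notin> A"
    by eventually_elim auto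
  then have "A \<in> null_sets lebesgue"
    using Al by (subst (asm) AE_iff_null_sets[symmetric]) auto
  then show False
    using A open_not_negligible by (auto simp: negligible_iff_null_sets)
qed

text \<open>A combination that is zero almost everywhere on a nonempty open set has uncountably many zeros
  there.\<close>

lemma sinc_kernels_independent:
  assumes "\<Omega> > 0" and A: "open A" "A \<noteq> {}" and y: "y \<in> cvec N"
    and zero: "AE t in lebesgue_on A. synthesis N (sinc_kernel \<Omega>) y t = 0"
  shows "y = (\<lambda>_. 0)"
proof
  fix m
  let ?Z = "{t \<in> A. synthesis N (sinc_kernel \<Omega>) y t = 0}"
  have unc: "uncountable ?Z"
    using A zero by (rule AE_lebesgue_on_open_uncountable)
  have "(\<Sum>k\<in>indices N. y k * complex_of_real (sinc (of_int k * pi + \<Omega> * t))) = 0" if "t \<in> ?Z" for t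
  proof -
    have "synthesis N (sinc_kernel \<Omega>) y t =
        complex_of_real (\<Omega> / pi) * (\<Sum>k\<in>indices N. y k * complex_of_real (sinc (of_int k * pi + \<Omega> * t)))"
      unfolding synthesis_def sinc_kernel_def sum_distrib_left of_real_mult
      by (intro sum.cong refl) (simp only: mult_ac)
    then show ?thesis using that \<open>\<Omega> > 0\<close> by simp
  qed
  then have "m \<in> indices N \<Longrightarrow> y m = 0"
    using shifted_sincs_independent[OF finite_indices _ unc, where \<Omega> = \<Omega> and c = y and m = m] \<open>\<Omega> > 0\<close> by blast
  then show "y m = 0"
    using y by (auto simp: cvec_def)
qed

theorem theorem3p2:
  fixes \<Omega> s :: real and q :: ereal and N :: nat and x :: "real \<Rightarrow> complex"
  defines "I \<equiv> einterval q (ereal s)"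
  assumes "\<Omega> > 0" and "q < ereal s" and "x \<in> L2 UNIV"
  shows "positive_definite N (opR \<Omega> N I) \<and>
    (bij_betw (opR \<Omega> N I) (cvec N) (cvec N) \<and>
     (\<forall>y. is_arg_min (\<lambda>y. G \<Omega> N I y x) (\<lambda>y. y \<in> cvec N) y
            \<longleftrightarrow> y = the_inv_into (cvec N) (opR \<Omega> N I) (opr \<Omega> N I x))) \<and>
    (\<forall>k\<in>indices N. \<forall>m\<in>indices N.
       matrix_entry (opR \<Omega> N I) k m = complex_of_real
         (\<Omega>\<^sup>2 / pi\<^sup>2 * (LINT t|lebesgue_on I. sinc (of_int m * pi + \<Omega> * t) * sinc (of_int k * pi + \<Omega> * t)))) \<and>
    (\<forall>k\<in>indices N.
       opr \<Omega> N I x k =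
         complex_of_real (\<Omega> / pi) * (LINT t|lebesgue_on I. complex_of_real (sinc (of_int k * pi + \<Omega> * t)) * x t))"
proof -
  let ?e = "sinc_kernel \<Omega>"
  define R where "R y = analysis I N ?e (synthesis N ?e y)" for y
  have I: "open I" "I \<noteq> {}" "I \<in> sets lebesgue"
    using einterval_nonempty[OF \<open>q < ereal s\<close>] by (auto simp: I_def)
  have e: "?e k \<in> L2 I" for k
    using \<open>\<Omega> > 0\<close> I(3) by (rule sinc_kernel_L2)
  have xI: "x \<in> L2 I"
    using \<open>x \<in> L2 UNIV\<close> I(3) by (rule L2_restrict)
  have ex: "is_expansion \<Omega> N I R (analysis I N ?e) (\<lambda>x. x)"
    unfolding R_def[abs_def] using e Q_eq_synthesis[OF \<open>\<Omega> > 0\<close>] by (rule least_squares_expansion)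
  then have R: "linear_hermitian_cvec N R"
    by (simp add: is_expansion_def)
  note opR = opR_opr_eq(1)[OF ex] and opr = opR_opr_eq(2)[OF ex xI]
  have pos: "positive_definite N R"
    unfolding R_def[abs_def] using e sinc_kernels_independent[OF \<open>\<Omega> > 0\<close> I(1,2)]
    by (rule Gram_positive_definite)
  have bij: "bij_betw R (cvec N) (cvec N)"
    using R pos by (rule positive_definite_bij)
  then have bij': "bij_betw (opR \<Omega> N I) (cvec N) (cvec N)"
    using opR by (subst bij_betw_cong)
  define z where "z = the_inv_into (cvec N) (opR \<Omega> N I) (opr \<Omega> N I x)"
  have rx: "opr \<Omega> N I x \<in> cvec N"
    unfolding opr by (rule analysis_cvec)
  have z: "z \<in> cvec N" "opR \<Omega> N I z = opr \<Omega> N I x"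
    unfolding z_def using bij' rx
    by (auto simp: bij_betw_def f_the_inv_into_f intro!: the_inv_into_into)
  have "matrix_entry (opR \<Omega> N I) k m = complex_of_real
      (\<Omega>\<^sup>2 / pi\<^sup>2 * (LINT t|lebesgue_on I. sinc (of_int m * pi + \<Omega> * t) * sinc (of_int k * pi + \<Omega> * t)))"
    if "k \<in> indices N" "m \<in> indices N" for k m
  proof -
    have "matrix_entry (opR \<Omega> N I) k m = L2_inner I (?e m) (?e k)"
      using that by (simp add: matrix_entry_def opR unit_cvec_in_cvec R_def synthesis_unit_cvec analysis_def)
    also have "\<dots> = (LINT t|lebesgue_on I. complex_of_real
        (\<Omega>\<^sup>2 / pi\<^sup>2 * (sinc (of_int m * pi + \<Omega> * t) * sinc (of_int k * pi + \<Omega> * t))))"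
      unfolding L2_inner_def sinc_kernel_def complex_cnj_complex_of_real of_real_mult[symmetric]
      by (intro arg_cong[of _ _ "integral\<^sup>L _"] ext arg_cong[of _ _ complex_of_real])
        (simp only: power2_eq_square times_divide_times_eq[symmetric] mult_ac)
    finally show ?thesis
      by (simp only: integral_complex_of_real integral_mult_right_zero)
  qed
  moreover have "opr \<Omega> N I x k =
      complex_of_real (\<Omega> / pi) * (LINT t|lebesgue_on I. complex_of_real (sinc (of_int k * pi + \<Omega> * t)) * x t)"
    if "k \<in> indices N" for k
  proof -
    have "opr \<Omega> N I x k = (LINT t|lebesgue_on I. complex_of_real (\<Omega> / pi) * (complex_of_real (sinc (of_int k * pi + \<Omega> * t)) * x t))"
      using that unfolding opr analysis_def L2_inner_def sinc_kernel_def of_real_mult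
      by (simp only: if_True complex_cnj_mult complex_cnj_complex_of_real mult_ac)
    then show ?thesis by (simp only: integral_mult_right_zero)
  qed
  moreover have "is_arg_min (\<lambda>y. G \<Omega> N I y x) (\<lambda>y. y \<in> cvec N) y \<longleftrightarrow> y = z" for y
    using ex pos xI z(1) by (rule expansion_minimizer) (use z opR opr in simp)
  moreover have "positive_definite N (opR \<Omega> N I)"
    using pos opR by (simp add: positive_definite_def)
  ultimately show ?thesis
    using bij' unfolding z_def by blast
qed

end
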